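(* Let $r\ge 1$. Among all families $\mathcal{S}=\{s_1,\dots,s_r\}$ of $r$ concatenated segments $s_i=[\xi_i,\xi_{i+1}]$, $i\in\{1,\dots,r\}$, with endpoints $-1\le\xi_1<\xi_2<\dots<\xi_{r+1}\le 1$, the concatenated segments $\widehat{\mathcal{S}}^{\mathrm{Fek}}$ that maximize the absolute value $|\det\widehat{V}(\mathcal{S})|$ of the determinant of the non-normalized Vandermonde matrix are uniquely determined as $$s_i=[\xi_i^{(LL)},\xi_{i+1}^{(LL)}],\qquad i\in\{1,\dots,r\},$$ where $\xi_1^{(LL)}<\dots<\xi_{r+1}^{(LL)}$ are the $r+1$ Legendre-Gauss-Lobatto nodes in $[-1,1]$, which solve the nodal Fekete problem for point sets of size $r+1$.
   Context: Let $\mathbb{P}_{r-1}$ be the space of real polynomials of degree at most $r-1$ and fix any basis $\{B_1,\dots,B_r\}$ of it (for instance $1,x,\dots,x^{r-1}$); the maximizers do not depend on this choice. The non-normalized Vandermonde matrix of a family of segments $\mathcal{S}=\{s_1,\dots,s_r\}$ is the $r\times r$ matrix with entries $\widehat{V}_{i,j}(\mathcal{S})=\int_{s_i}B_j(x)\,dx$. The Legendre-Gauss-Lobatto nodes for point sets of size $n\ge 2$ are the $n$ roots of the polynomial $(1-x^2)P_{n-1}'(x)$, where $P_{n-1}$ is the Legendre polynomial of degree $n-1$. The nodal Fekete problem for point sets of size $n$ is to find nodes $-1\le\xi_1<\dots<\xi_n\le 1$ maximizing $\prod_{1\le i<j\le n}|\xi_j-\xi_i|$. *)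

theory Defs
  imports
    "HOL-Analysis.Analysis"
    "HOL-Computational_Algebra.Polynomial"
    "Jordan_Normal_Form.Determinant"
begin

interpretation poly_vs: vector_space "Polynomial.smult :: real \<Rightarrow> real poly \<Rightarrow> real poly"
  by unfold_locales (simp_all add: smult_add_right smult_add_left)

text \<open>The family \<open>B 1, \<dots>, B r\<close> is a basis of the polynomials of degree at most \<open>r - 1\<close>
  (meaningful for \<open>r \<ge> 1\<close> only).\<close>

definition poly_basis :: "nat \<Rightarrow> (nat \<Rightarrow> real poly) \<Rightarrow> bool" where
  "poly_basis r B \<longleftrightarrow>
     inj_on B {1..r} \<and>
     \<not> poly_vs.dependent (B ` {1..r}) \<and>
     poly_vs.span (B ` {1..r}) = {p. degree p \<le> r - 1}"

definition ordered_nodes :: "nat \<Rightarrow> (nat \<Rightarrow> real) \<Rightarrow> bool" where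
  "ordered_nodes n \<xi> \<longleftrightarrow> strict_mono_on {1..n} \<xi> \<and> \<xi> ` {1..n} \<subseteq> {-1..1}"

definition concatenated_segments :: "nat \<Rightarrow> (nat \<Rightarrow> real set) \<Rightarrow> bool" where
  "concatenated_segments r S \<longleftrightarrow>
     (\<exists>\<xi>. ordered_nodes (r + 1) \<xi> \<and> (\<forall>i\<in>{1..r}. S i = {\<xi> i..\<xi> (i + 1)}))"

text \<open>Families are indexed from 1, matrices of type \<open>real mat\<close> from 0.\<close>

definition vandermonde_segments ::
    "nat \<Rightarrow> (nat \<Rightarrow> real poly) \<Rightarrow> (nat \<Rightarrow> real set) \<Rightarrow> real mat" where
  "vandermonde_segments r B S =
     Matrix.mat r r (\<lambda>(i, j). integral (S (i + 1)) (\<lambda>x. poly (B (j + 1)) x))"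

definition fekete_segments ::
    "nat \<Rightarrow> (nat \<Rightarrow> real poly) \<Rightarrow> (nat \<Rightarrow> real set) \<Rightarrow> bool" where
  "fekete_segments r B =
     is_arg_max (\<lambda>S. \<bar>Determinant.det (vandermonde_segments r B S)\<bar>) (concatenated_segments r)"

definition fekete_nodes :: "nat \<Rightarrow> (nat \<Rightarrow> real) \<Rightarrow> bool" where
  "fekete_nodes n =
     is_arg_max (\<lambda>\<xi>. \<Prod>(i, j)\<in>{(i, j). 1 \<le> i \<and> i < j \<and> j \<le> n}. \<bar>\<xi> j - \<xi> i\<bar>) (ordered_nodes n)"

text \<open>Rodrigues' formula.\<close>

definition legendre_poly :: "nat \<Rightarrow> real poly" where
  "legendre_poly n = Polynomial.smult (1 / (2 ^ n * fact n)) ((pderiv ^^ n) ([:-1, 0, 1:] ^ n))"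

definition lobatto_roots :: "nat \<Rightarrow> real set" where
  "lobatto_roots n = {x. (1 - x\<^sup>2) * poly (pderiv (legendre_poly (n - 1))) x = 0}"

definition lobatto_node :: "nat \<Rightarrow> nat \<Rightarrow> real" where
  "lobatto_node n i = sorted_list_of_set (lobatto_roots n) ! (i - 1)"

end

theory Submission
  imports Defs
begin

text \<open>Written in the basis of derivatives of the Newton polynomials
  \<open>\<Prod>l\<le>j. (x - \<xi> l)\<close>, the Vandermonde matrix of concatenated segments is triangular, with
  diagonal entries \<open>\<Prod>l\<le>j. (\<xi> (j + 1) - \<xi> l)\<close>. Hence, up to a nonzero constant depending only on
  the basis, its determinant is the classical Vandermonde product of the \<open>r + 1\<close> endpoints,
  and the problem reduces to the nodal Fekete problem.

  A nodal maximizer exists by compactness. Moving a single node shows that the extreme nodes are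
  \<open>\<plusminus>1\<close> and that the nodal polynomial \<open>\<omega>\<close> satisfies \<open>\<omega>'' = 0\<close> at the interior nodes. So
  \<open>(1 - x\<^sup>2) \<omega>''\<close> vanishes at all nodes, and comparing leading coefficients gives
  \<open>(1 - x\<^sup>2) \<omega>'' = - n (n - 1) \<omega>\<close>. By Legendre's equation \<open>(1 - x\<^sup>2) P'\<close> with \<open>P\<close> the Legendre
  polynomial of degree \<open>n - 1\<close> solves the same equation, whose polynomial solutions of degree \<open>n\<close>
  are proportional. Thus every maximizer consists of the Lobatto nodes.\<close>

section \<open>Reduction to the nodal problem\<close>

lemma poly_eq_sum_lessThan:
  fixes p :: "real poly"
  assumes "degree p < r"
  shows "poly p x = (\<Sum>k<r. coeff p k * x ^ k)"
  unfolding poly_altdef using assms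
  by (intro sum.mono_neutral_left) (auto simp: coeff_eq_0)

text \<open>Expanding each basis element in monomials and integrating termwise separates the
  dependence on the segments (left factor) from that on the basis (right factor).\<close>

lemma vandermonde_segments_eq_mult:
  assumes deg: "\<And>j. j < r \<Longrightarrow> degree (B (j + 1)) < r"
    and S: "\<And>i. i < r \<Longrightarrow> \<exists>a b. S (i + 1) = {a..b}"
  shows "vandermonde_segments r B S =
    vandermonde_segments r (\<lambda>j. Polynomial.monom 1 (j - 1)) S *
      Matrix.mat r r (\<lambda>(k, j). coeff (B (j + 1)) k)"
proof (rule eq_matI, goal_cases)
  case (1 i j)
  then have ij: "i < r" "j < r" by (simp_all add: vandermonde_segments_def)
  from S[OF ij(1)] obtain a b where ab: "S (Suc i) = {a..b}" by auto
  have "integral {a..b} (poly (B (j + 1)))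
      = integral {a..b} (\<lambda>x. \<Sum>k<r. coeff (B (j + 1)) k * x ^ k)"
    using poly_eq_sum_lessThan[OF deg[OF ij(2)]] by presburger
  also have "\<dots> = (\<Sum>k<r. integral {a..b} (\<lambda>x. coeff (B (j + 1)) k * x ^ k))"
    by (intro integral_sum integrable_continuous_real continuous_intros) auto
  also have "\<dots> = (\<Sum>k<r. integral {a..b} (\<lambda>x. x ^ k) * coeff (B (j + 1)) k)"
    by (simp add: mult.commute)
  finally show ?case
    using ij ab
    by (simp add: vandermonde_segments_def scalar_prod_def poly_monom atLeast0LessThan)
qed (auto simp: vandermonde_segments_def)

lemma vandermonde_segments_carrier: "vandermonde_segments r B S \<in> carrier_mat r r"
  by (simp add: vandermonde_segments_def)

lemma det_vandermonde_segments_eq_mult: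
  assumes "\<And>j. j < r \<Longrightarrow> degree (B (j + 1)) < r"
    and "\<And>i. i < r \<Longrightarrow> \<exists>a b. S (i + 1) = {a..b}"
  shows "Determinant.det (vandermonde_segments r B S) =
    Determinant.det (vandermonde_segments r (\<lambda>j. Polynomial.monom 1 (j - 1)) S) *
      Determinant.det (Matrix.mat r r (\<lambda>(k, j). coeff (B (j + 1)) k))"
  by (subst vandermonde_segments_eq_mult, fact assms(1), fact assms(2))
     (rule det_mult[OF vandermonde_segments_carrier], simp)

section \<open>Newton polynomials and the triangular form\<close>

definition newton_poly :: "(nat \<Rightarrow> real) \<Rightarrow> nat \<Rightarrow> real poly" where
  "newton_poly \<xi> n = (\<Prod>l\<in>{1..n}. [:- \<xi> l, 1:])"

lemma degree_newton_poly: "degree (newton_poly \<xi> n) = n"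
  unfolding newton_poly_def by (subst degree_prod_eq_sum_degree) auto

lemma coeff_newton_poly_same: "coeff (newton_poly \<xi> n) n = 1"
proof -
  have "lead_coeff (newton_poly \<xi> n) = 1"
    unfolding newton_poly_def lead_coeff_prod by simp
  then show ?thesis by (simp add: degree_newton_poly)
qed

lemma poly_newton_poly: "poly (newton_poly \<xi> n) x = (\<Prod>l\<in>{1..n}. x - \<xi> l)"
  by (simp add: newton_poly_def poly_prod)

lemma poly_newton_poly_node:
  assumes "l \<in> {1..n}"
  shows "poly (newton_poly \<xi> n) (\<xi> l) = 0"
  using assms by (auto simp: poly_newton_poly)

lemma integral_poly_pderiv:
  fixes p :: "real poly"
  assumes "a \<le> b"
  shows "integral {a..b} (poly (pderiv p)) = poly p b - poly p a"
  by (intro integral_unique fundamental_theorem_of_calculus assms)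
     (auto simp: has_real_derivative_iff_has_vector_derivative[symmetric]
           intro!: DERIV_subset[OF poly_DERIV])

text \<open>By the fundamental theorem of calculus each entry is a difference of values of a Newton
  polynomial at two consecutive nodes, which makes the matrix lower triangular.\<close>

lemma det_vandermonde_segments_newton:
  assumes S: "\<And>i. i < r \<Longrightarrow> S (i + 1) = {\<xi> (i + 1)..\<xi> (i + 2)}"
    and le: "\<And>i. i < r \<Longrightarrow> \<xi> (i + 1) \<le> \<xi> (i + 2)"
  shows "Determinant.det (vandermonde_segments r (\<lambda>j. pderiv (newton_poly \<xi> j)) S)
    = (\<Prod>j<r. \<Prod>l\<in>{1..j + 1}. \<xi> (j + 2) - \<xi> l)"
proof -
  let ?V = "vandermonde_segments r (\<lambda>j. pderiv (newton_poly \<xi> j)) S"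
  have entry: "?V $$ (i, j)
      = poly (newton_poly \<xi> (j + 1)) (\<xi> (i + 2)) - poly (newton_poly \<xi> (j + 1)) (\<xi> (i + 1))"
    if "i < r" "j < r" for i j
    using that S[OF that(1)] integral_poly_pderiv[OF le[OF that(1)]]
    by (simp add: vandermonde_segments_def)
  have "Determinant.det ?V = prod_list (diag_mat ?V)"
  proof (rule det_lower_triangular[OF _ vandermonde_segments_carrier])
    \<comment> \<open>The row with index \<open>i\<close> belongs to the segment between the nodes
      \<open>i + 1\<close> and \<open>i + 2\<close>; both are roots of
      \<open>newton_poly \<xi> (j + 1)\<close> if \<open>i < j\<close>. On the diagonal only the
      left endpoint is a root.\<close>
    fix i j assume "i < j" "j < r"
    then show "?V $$ (i, j) = 0"
      using poly_newton_poly_node[of "i + 2" "j + 1" \<xi>] poly_newton_poly_node[of "i + 1" "j + 1" \<xi>]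
      by (simp add: entry)
  qed
  also have "\<dots> = (\<Prod>j<r. ?V $$ (j, j))"
    by (simp add: prod_list_diag_prod vandermonde_segments_def atLeast0LessThan)
  also have "\<dots> = (\<Prod>j<r. \<Prod>l\<in>{1..j + 1}. \<xi> (j + 2) - \<xi> l)"
  proof (rule prod.cong[OF refl])
    fix j assume "j \<in> {..<r}"
    then show "?V $$ (j, j) = (\<Prod>l\<in>{1..j + 1}. \<xi> (j + 2) - \<xi> l)"
      using poly_newton_poly_node[of "j + 1" "j + 1" \<xi>]
      by (simp only: entry lessThan_iff poly_newton_poly) simp
  qed
  finally show ?thesis .
qed

text \<open>The Newton basis moves with the nodes, but its change-of-basis determinant does not: the
  matrix is triangular and the polynomials are monic.\<close>

lemma det_coeff_newton:
  "Determinant.det (Matrix.mat r r (\<lambda>(k, j). coeff (pderiv (newton_poly \<xi> (j + 1))) k)) = fact r"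
proof -
  let ?A = "Matrix.mat r r (\<lambda>(k, j). coeff (pderiv (newton_poly \<xi> (j + 1))) k)"
  have "Determinant.det ?A = prod_list (diag_mat ?A)"
    by (rule det_upper_triangular[where n = r])
       (auto intro!: coeff_eq_0 simp: degree_pderiv degree_newton_poly upper_triangular_def)
  also have "\<dots> = (\<Prod>j<r. real (Suc j))"
    using coeff_newton_poly_same
    by (simp add: prod_list_diag_prod atLeast0LessThan coeff_pderiv)
  also have "\<dots> = fact r"
    by (induction r) (simp_all add: algebra_simps)
  finally show ?thesis .
qed

lemma poly_basis_degree_less:
  assumes "poly_basis r B" "r \<ge> 1" "j < r"
  shows "degree (B (j + 1)) < r"
proof -
  have "B (j + 1) \<in> poly_vs.span (B ` {1..r})"
    using assms(3) by (intro poly_vs.span_base) auto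
  then show ?thesis
    using assms unfolding poly_basis_def by auto
qed

text \<open>Writing the monomials in terms of \<open>B\<close> yields a right inverse of the
  coefficient matrix.\<close>

lemma det_coeff_poly_basis:
  assumes B: "poly_basis r B" and r: "r \<ge> 1"
  shows "Determinant.det (Matrix.mat r r (\<lambda>(k, j). coeff (B (j + 1)) k)) \<noteq> 0"
proof -
  let ?A = "Matrix.mat r r (\<lambda>(k, j). coeff (B (j + 1)) k)"
  have "\<exists>u. Polynomial.monom 1 l = (\<Sum>j\<in>{1..r}. Polynomial.smult (u j) (B j))" if "l < r" for l
  proof -
    have "Polynomial.monom 1 l \<in> poly_vs.span (B ` {1..r})"
      using B that by (auto simp: poly_basis_def degree_monom_eq)
    then obtain v where "Polynomial.monom 1 l = (\<Sum>b\<in>B ` {1..r}. Polynomial.smult (v b) b)"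
      by (auto simp: poly_vs.span_finite)
    also have "\<dots> = (\<Sum>j\<in>{1..r}. Polynomial.smult (v (B j)) (B j))"
      using B by (subst sum.reindex) (auto simp: poly_basis_def)
    finally show ?thesis by (rule exI[of _ "\<lambda>j. v (B j)"])
  qed
  then obtain u where
    u: "\<And>l. l < r \<Longrightarrow> Polynomial.monom 1 l = (\<Sum>j\<in>{1..r}. Polynomial.smult (u l j) (B j))"
    by metis
  let ?U = "Matrix.mat r r (\<lambda>(j, l). u l (j + 1))"
  have "?A * ?U = 1\<^sub>m r"
  proof (rule eq_matI, goal_cases)
    case (1 k l)
    then have kl: "k < r" "l < r" by simp_all
    have "(if k = l then 1 else 0) = coeff (\<Sum>j\<in>{1..r}. Polynomial.smult (u l j) (B j)) k"
      unfolding u[OF kl(2), symmetric] by simp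
    also have "\<dots> = (\<Sum>j\<in>{1..r}. u l j * coeff (B j) k)"
      by (simp add: coeff_sum)
    also have "\<dots> = (\<Sum>j<r. u l (Suc j) * coeff (B (Suc j)) k)"
      by (rule sum.reindex_bij_witness[of _ Suc "\<lambda>j. j - 1"]) auto
    finally show ?case
      using kl by (simp add: scalar_prod_def atLeast0LessThan mult.commute)
  qed auto
  then have "Determinant.det ?A * Determinant.det ?U = 1"
    by (metis det_mult det_one mat_carrier)
  then show ?thesis by auto
qed

definition node_prod :: "nat \<Rightarrow> (nat \<Rightarrow> real) \<Rightarrow> real" where
  "node_prod n \<xi> = (\<Prod>(i, j)\<in>{(i, j). 1 \<le> i \<and> i < j \<and> j \<le> n}. \<bar>\<xi> j - \<xi> i\<bar>)"

text \<open>Pairs are grouped by their larger index, here \<open>j + 2\<close>, to match the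
  diagonal product of the Newton matrix.\<close>

lemma node_prod_Suc: "node_prod (r + 1) \<xi> = (\<Prod>j<r. \<Prod>l\<in>{1..j + 1}. \<bar>\<xi> (j + 2) - \<xi> l\<bar>)"
  unfolding node_prod_def
  by (subst prod.Sigma, simp, simp)
     (rule prod.reindex_bij_witness[of _ "\<lambda>(j, l). (l, j + 2)" "\<lambda>(l, j). (j - 2, l)"],
      auto simp: numeral_2_eq_2 Suc_diff_Suc)

text \<open>Both \<open>B\<close> and the Newton basis are compared with the monomial basis. The
  constant is fixed before \<open>S\<close> and \<open>\<xi>\<close>, so it cannot affect the
  maximization.\<close>

lemma abs_det_vandermonde_segments:
  assumes "poly_basis r B" "r \<ge> 1"
  obtains c where "c > 0"
    and "\<And>S \<xi>. ordered_nodes (r + 1) \<xi> \<Longrightarrow> \<forall>i\<in>{1..r}. S i = {\<xi> i..\<xi> (i + 1)} \<Longrightarrow>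
      \<bar>Determinant.det (vandermonde_segments r B S)\<bar> = c * node_prod (r + 1) \<xi>"
proof
  let ?b = "Determinant.det (Matrix.mat r r (\<lambda>(k, j). coeff (B (j + 1)) k))"
  show "\<bar>?b\<bar> / fact r > 0"
    using det_coeff_poly_basis[OF assms] by simp
  fix S \<xi>
  assume \<xi>: "ordered_nodes (r + 1) \<xi>" and S: "\<forall>i\<in>{1..r}. S i = {\<xi> i..\<xi> (i + 1)}"
  let ?M = "Determinant.det (vandermonde_segments r (\<lambda>j. Polynomial.monom 1 (j - 1)) S)"
  have S': "S (i + 1) = {\<xi> (i + 1)..\<xi> (i + 2)}" if "i < r" for i
    using S that by auto
  have le: "\<xi> (i + 1) \<le> \<xi> (i + 2)" if "i < r" for i
    using \<xi> that by (intro less_imp_le) (auto simp: ordered_nodes_def strict_mono_on_def)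
  have I: "\<exists>a b. S (i + 1) = {a..b}" if "i < r" for i
    using S' that by blast
  have "?M * fact r = (\<Prod>j<r. \<Prod>l\<in>{1..j + 1}. \<xi> (j + 2) - \<xi> l)"
    using det_vandermonde_segments_eq_mult[of r "\<lambda>j. pderiv (newton_poly \<xi> j)" S] I
      det_vandermonde_segments_newton[of r S \<xi>] S' le
    by (simp add: det_coeff_newton[simplified] degree_pderiv degree_newton_poly)
  then have "\<bar>?M * fact r\<bar> = node_prod (r + 1) \<xi>"
    by (simp only: node_prod_Suc abs_prod)
  then have "\<bar>?M\<bar> = node_prod (r + 1) \<xi> / fact r"
    by (simp add: abs_mult field_simps)
  then show "\<bar>Determinant.det (vandermonde_segments r B S)\<bar> = \<bar>?b\<bar> / fact r * node_prod (r + 1) \<xi>"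
    using det_vandermonde_segments_eq_mult[of r B S] poly_basis_degree_less[OF assms] I
    by (simp add: abs_mult)
qed

section \<open>The Lobatto differential equation\<close>

text \<open>The case \<open>m = n\<close> for \<open>u = (x\<^sup>2 - 1) ^ n\<close> is Legendre's equation.\<close>

lemma higher_pderiv_rodrigues:
  fixes u :: "real poly"
  assumes u: "[:-1, 0, 1:] * pderiv u = Polynomial.smult (2 * of_nat n) ([:0, 1:] * u)"
  shows "[:-1, 0, 1:] * (pderiv ^^ (m + 2)) u
    + Polynomial.smult (2 * (of_nat m + 1) - 2 * of_nat n) ([:0, 1:] * (pderiv ^^ (m + 1)) u)
    + Polynomial.smult (of_nat m * (of_nat m + 1) - 2 * of_nat n * (of_nat m + 1)) ((pderiv ^^ m) u) = 0"
proof (induction m)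
  case 0
  \<comment> \<open>The base case is the hypothesis differentiated once; the induction step
    differentiates once more.\<close>
  have "poly (pderiv ([:-1, 0, 1:] * pderiv u)) x
      = poly (pderiv (Polynomial.smult (2 * of_nat n) ([:0, 1:] * u))) x" for x
    unfolding u ..
  then show ?case
    by (simp add: poly_eq_poly_eq_iff[symmetric] fun_eq_iff pderiv_mult pderiv_smult
         pderiv_pCons algebra_simps del: mult_pCons_left mult_pCons_right)
next
  case (Suc m)
  from arg_cong[OF Suc.IH, of "\<lambda>p. poly (pderiv p)",
      unfolded pderiv_add pderiv_smult pderiv_mult] show ?case
    by (simp add: poly_eq_poly_eq_iff[symmetric] fun_eq_iff pderiv_pCons
         algebra_simps del: mult_pCons_left mult_pCons_right)
qed

text \<open>For \<open>m = n\<close> the lower-order coefficients in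
  \<open>higher_pderiv_rodrigues\<close> become \<open>2\<close> and
  \<open>- n (n + 1)\<close>.\<close>

lemma legendre_ode:
  fixes n :: nat
  defines "p \<equiv> legendre_poly n"
  shows "[:-1, 0, 1:] * pderiv (pderiv p) + Polynomial.smult 2 ([:0, 1:] * pderiv p)
    = Polynomial.smult (of_nat n * (of_nat n + 1)) p"
proof -
  define u :: "real poly" where "u = [:-1, 0, 1:] ^ n"
  have "[:-1, 0, 1:] * pderiv u = Polynomial.smult (2 * of_nat n) ([:0, 1:] * u)"
    by (cases n) (simp_all add: u_def pderiv_power_Suc pderiv_pCons algebra_simps
        del: mult_pCons_left mult_pCons_right power_Suc, simp_all add: algebra_simps smult_add_left)
  from higher_pderiv_rodrigues[OF this, of n]
  show ?thesis
    unfolding p_def legendre_poly_def u_def[symmetric]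
    by (simp add: pderiv_smult poly_eq_poly_eq_iff[symmetric] fun_eq_iff field_simps)
qed

lemma degree_legendre_poly: "degree (legendre_poly n) = n"
  by (simp add: legendre_poly_def degree_higher_pderiv degree_power_eq)

definition lobatto_poly :: "nat \<Rightarrow> real poly" where
  "lobatto_poly n = [:1, 0, -1:] * pderiv (legendre_poly (n - 1))"

lemma degree_lobatto_poly:
  assumes "n \<ge> 2"
  shows "degree (lobatto_poly n) = n"
proof -
  have "degree (pderiv (legendre_poly (n - 1))) = n - 2"
    by (simp add: degree_pderiv degree_legendre_poly)
  moreover have "pderiv (legendre_poly (n - 1)) \<noteq> 0"
    using assms degree_legendre_poly[of "n - 1"] by (auto simp: pderiv_eq_0_iff)
  ultimately show ?thesis
    unfolding lobatto_poly_def using assms by (subst degree_mult_eq) auto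
qed

text \<open>Legendre's equation for \<open>p\<close> of degree \<open>n - 1\<close> says that the
  derivative of \<open>lobatto_poly n\<close> is \<open>- n (n - 1) p\<close>. Differentiating again
  and multiplying by \<open>1 - x^2\<close> restores \<open>lobatto_poly n\<close> on the
  right.\<close>

lemma lobatto_poly_ode:
  assumes "n \<ge> 1"
  shows "[:1, 0, -1:] * pderiv (pderiv (lobatto_poly n))
    = Polynomial.smult (- (of_nat n * (of_nat n - 1))) (lobatto_poly n)"
proof -
  define p where "p = legendre_poly (n - 1)"
  have "pderiv (lobatto_poly n)
      = - ([:-1, 0, 1:] * pderiv (pderiv p) + Polynomial.smult 2 ([:0, 1:] * pderiv p))"
    unfolding lobatto_poly_def p_def[symmetric]
    by (simp add: poly_eq_poly_eq_iff[symmetric] fun_eq_iff pderiv_mult pderiv_pCons algebra_simps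
        del: mult_pCons_left mult_pCons_right)
  also have "\<dots> = Polynomial.smult (- (of_nat n * (of_nat n - 1))) p"
    unfolding p_def legendre_ode using assms by (simp add: of_nat_diff algebra_simps)
  finally show ?thesis
    by (simp add: lobatto_poly_def p_def pderiv_smult pderiv_minus)
qed

text \<open>Above the degree all coefficients vanish, so only the \<open>- x^2\<close> part
  contributes at \<open>m\<close>.\<close>

lemma coeff_lobatto_operator:
  fixes p :: "real poly"
  assumes "degree p \<le> m"
  shows "coeff ([:1, 0, -1:] * pderiv (pderiv p)) m = - (of_nat m * (of_nat m - 1) * coeff p m)"
proof -
  have *: "coeff p (Suc m) = 0" "coeff p (Suc (Suc m)) = 0"
    using assms by (auto intro: coeff_eq_0)
  show ?thesis
    using * by (cases m; cases "m - 1") (auto simp: coeff_pderiv algebra_simps)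
qed

text \<open>The leading coefficient of a nonzero solution of degree \<open>m\<close> forces
  \<open>m (m - 1) = n (n - 1)\<close>, impossible for \<open>m < n\<close>. Applied to differences,
  this gives uniqueness up to scaling in degree \<open>n\<close>.\<close>

lemma lobatto_ode_low_degree:
  fixes p :: "real poly"
  assumes ode: "[:1, 0, -1:] * pderiv (pderiv p) = Polynomial.smult (- (of_nat n * (of_nat n - 1))) p"
    and deg: "degree p < n" and n: "n \<ge> 2"
  shows "p = 0"
proof (rule ccontr)
  assume "p \<noteq> 0"
  define m where "m = degree p"
  have "coeff p m \<noteq> 0" using \<open>p \<noteq> 0\<close> by (simp add: m_def)
  moreover have "- (of_nat m * (of_nat m - 1) * coeff p m) = - (of_nat n * (of_nat n - 1) * coeff p m)"
    using coeff_lobatto_operator[of p m] unfolding ode by (simp add: m_def algebra_simps)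
  ultimately have "real m * (real m - 1) = real n * (real n - 1)"
    by (metis minus_mult_left mult_cancel_right neg_equal_iff_equal)
  then have "(real n - real m) * (real n + real m - 1) = 0"
    by (simp add: algebra_simps)
  then show False
    using deg n by (auto simp: m_def)
qed

section \<open>The nodal Fekete problem\<close>

lemma node_prod_cong:
  assumes "\<And>i. i \<in> {1..n} \<Longrightarrow> \<xi> i = \<eta> i"
  shows "node_prod n \<xi> = node_prod n \<eta>"
  unfolding node_prod_def using assms by (intro prod.cong) auto

lemma ordered_nodes_iff:
  "ordered_nodes n \<xi> \<longleftrightarrow>
    (\<forall>i j. 1 \<le> i \<longrightarrow> i < j \<longrightarrow> j \<le> n \<longrightarrow> \<xi> i < \<xi> j) \<and>
    (\<forall>i. 1 \<le> i \<longrightarrow> i \<le> n \<longrightarrow> -1 \<le> \<xi> i \<and> \<xi> i \<le> 1)"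
  unfolding ordered_nodes_def strict_mono_on_def image_subset_iff
  by (auto dest: less_imp_le)

lemma ordered_nodes_less: "ordered_nodes n \<xi> \<Longrightarrow> 1 \<le> i \<Longrightarrow> i < j \<Longrightarrow> j \<le> n \<Longrightarrow> \<xi> i < \<xi> j"
  by (auto simp: ordered_nodes_iff)

lemma ordered_nodes_mono: "ordered_nodes n \<xi> \<Longrightarrow> 1 \<le> i \<Longrightarrow> i \<le> j \<Longrightarrow> j \<le> n \<Longrightarrow> \<xi> i \<le> \<xi> j"
  by (cases "i = j") (auto dest: ordered_nodes_less[of n \<xi> i j])

lemma ordered_nodes_bounds: "ordered_nodes n \<xi> \<Longrightarrow> 1 \<le> i \<Longrightarrow> i \<le> n \<Longrightarrow> -1 \<le> \<xi> i \<and> \<xi> i \<le> 1"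
  by (auto simp: ordered_nodes_iff)

lemma ordered_nodes_inj_on: "ordered_nodes n \<xi> \<Longrightarrow> inj_on \<xi> {1..n}"
  by (auto simp: ordered_nodes_def intro: strict_mono_on_imp_inj_on)

lemma ordered_nodes_cong:
  assumes "\<And>i. i \<in> {1..n} \<Longrightarrow> \<xi> i = \<eta> i"
  shows "ordered_nodes n \<xi> = ordered_nodes n \<eta>"
  unfolding ordered_nodes_iff using assms by auto

lemma ordered_nodes_fun_upd:
  assumes "ordered_nodes n \<xi>"
    and "\<And>i. 1 \<le> i \<Longrightarrow> i < k \<Longrightarrow> \<xi> i < t" "\<And>i. k < i \<Longrightarrow> i \<le> n \<Longrightarrow> t < \<xi> i"
    and "-1 \<le> t" "t \<le> 1"
  shows "ordered_nodes n (\<xi>(k := t))"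
  using assms unfolding ordered_nodes_iff by auto

lemma finite_ordered_pairs: "finite {(i, j). 1 \<le> i \<and> i < j \<and> j \<le> (n :: nat)}"
  by (rule finite_subset[of _ "{..n} \<times> {..n}"]) auto

lemma node_prod_pos:
  assumes "ordered_nodes n \<xi>"
  shows "node_prod n \<xi> > 0"
  unfolding node_prod_def using assms
  by (intro prod_pos) (auto dest: ordered_nodes_less)

lemma fekete_nodes_iff:
  "fekete_nodes n \<xi> \<longleftrightarrow>
    ordered_nodes n \<xi> \<and> (\<forall>\<eta>. ordered_nodes n \<eta> \<longrightarrow> node_prod n \<eta> \<le> node_prod n \<xi>)"
  unfolding fekete_nodes_def is_arg_max_def node_prod_def by (auto simp: not_less)

section \<open>Existence of a nodal maximizer\<close>

lemma compact_sorted_node_families: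
  "compact ({\<xi> :: nat \<Rightarrow> real. \<forall>i. \<xi> i \<in> {-1..1}} \<inter> {\<xi>. \<forall>i\<in>{1..n}. \<forall>j\<in>{i..n}. \<xi> i \<le> \<xi> j})"
proof (rule compact_Int_closed)
  \<comment> \<open>Tychonoff's theorem: every coordinate is bounded, also those beyond
    \<open>n\<close>. Closedness below relies on the weak order, which admits coinciding
    nodes.\<close>
  have "compactin (product_topology (\<lambda>i. euclidean) UNIV) (PiE UNIV (\<lambda>i :: nat. {-1..1 :: real}))"
    by (subst compactin_PiE) auto
  then show "compact {\<xi> :: nat \<Rightarrow> real. \<forall>i. \<xi> i \<in> {-1..1}}"
    by (simp add: euclidean_product_topology PiE_UNIV_domain Pi_def)
  show "closed {\<xi> :: nat \<Rightarrow> real. \<forall>i\<in>{1..n}. \<forall>j\<in>{i..n}. \<xi> i \<le> \<xi> j}"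
    by (simp only: Ball_def)
       (intro closed_Collect_all closed_Collect_imp open_Collect_const closed_Collect_le
         continuous_on_product_coordinates)
qed

lemma fekete_nodes_exist: "\<exists>\<xi>. fekete_nodes n \<xi>"
proof -
  define K where "K = {\<xi> :: nat \<Rightarrow> real. \<forall>i. \<xi> i \<in> {-1..1}}
    \<inter> {\<xi>. \<forall>i\<in>{1..n}. \<forall>j\<in>{i..n}. \<xi> i \<le> \<xi> j}"
  have "continuous_on K (node_prod n)"
    unfolding node_prod_def case_prod_unfold
    by (intro continuous_intros continuous_on_subset[OF continuous_on_product_coordinates]) auto
  moreover have "(\<lambda>_. 0) \<in> K" by (simp add: K_def)
  ultimately obtain \<xi> where \<xi>: "\<xi> \<in> K" and max: "\<And>\<eta>. \<eta> \<in> K \<Longrightarrow> node_prod n \<eta> \<le> node_prod n \<xi>"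
    using continuous_attains_sup[of K "node_prod n"] compact_sorted_node_families[of n]
    unfolding K_def by (metis (lifting) empty_iff)
  have le: "node_prod n \<eta> \<le> node_prod n \<xi>" if \<eta>: "ordered_nodes n \<eta>" for \<eta>
  proof -
    \<comment> \<open>Values outside \<open>{1..n}\<close> are arbitrary in an ordered family;
      resetting them to \<open>0\<close> puts it into \<open>K\<close> without changing the
      product.\<close>
    define \<eta>' where "\<eta>' i = (if i \<in> {1..n} then \<eta> i else 0)" for i
    have "\<eta>' \<in> K"
      using \<eta> by (auto simp: K_def \<eta>'_def ordered_nodes_bounds ordered_nodes_mono)
    then show ?thesis
      using max node_prod_cong[of n \<eta> \<eta>'] by (simp add: \<eta>'_def)
  qed
  \<comment> \<open>Some ordered family has a positive product, so the maximum over \<open>K\<close>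
    is positive and its nodes cannot coincide.\<close>
  have "ordered_nodes n (\<lambda>i. real i / real n)"
    by (auto simp: ordered_nodes_iff field_simps intro: order_trans[of _ 0])
  then have "node_prod n \<xi> > 0"
    using le node_prod_pos by (meson less_le_trans)
  moreover have "node_prod n \<xi> = 0" if "i \<in> {1..n}" "j \<in> {i<..n}" "\<xi> i = \<xi> j" for i j
    unfolding node_prod_def using that
    by (intro prod_zero finite_ordered_pairs bexI[of _ "(i, j)"]) auto
  ultimately have "\<xi> i \<noteq> \<xi> j" if "i \<in> {1..n}" "j \<in> {i<..n}" for i j
    using that by (metis less_irrefl)
  moreover have "\<xi> i \<le> \<xi> j" if "i \<in> {1..n}" "j \<in> {i..n}" for i j
    using \<xi> that by (simp add: K_def)
  moreover have "-1 \<le> \<xi> i \<and> \<xi> i \<le> 1" for i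
    using \<xi> by (simp add: K_def)
  ultimately have "ordered_nodes n \<xi>"
    by (simp add: ordered_nodes_iff order.strict_iff_order)
  then show ?thesis
    using le by (auto simp: fekete_nodes_iff)
qed

section \<open>Variation of a single node\<close>

lemma node_prod_remove:
  assumes k: "k \<in> {1..n}"
  shows "node_prod n \<xi> =
    (\<Prod>(i, j)\<in>{(i, j). 1 \<le> i \<and> i < j \<and> j \<le> n \<and> i \<noteq> k \<and> j \<noteq> k}. \<bar>\<xi> j - \<xi> i\<bar>) *
    (\<Prod>j\<in>{1..n} - {k}. \<bar>\<xi> k - \<xi> j\<bar>)"
proof -
  let ?P = "{(i, j). 1 \<le> i \<and> i < j \<and> j \<le> n}" and ?f = "\<lambda>(i, j). \<bar>\<xi> j - \<xi> i\<bar>"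
  let ?A = "{(i, j). 1 \<le> i \<and> i < j \<and> j \<le> n \<and> i \<noteq> k \<and> j \<noteq> k}"
  have "node_prod n \<xi> = prod ?f (?P - ?A) * prod ?f ?A"
    unfolding node_prod_def by (intro prod.subset_diff finite_ordered_pairs) auto
  also have "prod ?f (?P - ?A) = (\<Prod>j\<in>{1..n} - {k}. \<bar>\<xi> k - \<xi> j\<bar>)"
    \<comment> \<open>A pair containing \<open>k\<close> is identified with its other index.\<close>
    by (rule prod.reindex_bij_witness[of _ "\<lambda>j. (min j k, max j k)" "\<lambda>(i, j). if i = k then j else i"])
       (use k in \<open>auto simp: min_def max_def\<close>)
  finally show ?thesis by (simp add: mult.commute)
qed

text \<open>The pairs avoiding \<open>k\<close> contribute the same positive factor before and after
  the move, which cancels.\<close>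

lemma fekete_nodes_move_one:
  assumes \<xi>: "fekete_nodes n \<xi>" and k: "k \<in> {1..n}" and t: "ordered_nodes n (\<xi>(k := t))"
  shows "(\<Prod>j\<in>{1..n} - {k}. \<bar>t - \<xi> j\<bar>) \<le> (\<Prod>j\<in>{1..n} - {k}. \<bar>\<xi> k - \<xi> j\<bar>)"
proof -
  let ?A = "{(i, j). 1 \<le> i \<and> i < j \<and> j \<le> n \<and> i \<noteq> k \<and> j \<noteq> k}"
  let ?C = "\<Prod>(i, j)\<in>?A. \<bar>\<xi> j - \<xi> i\<bar>"
  have "?C > 0"
    using \<xi> by (intro prod_pos) (auto simp: fekete_nodes_iff dest: ordered_nodes_less)
  have "(\<Prod>(i, j)\<in>?A. \<bar>(\<xi>(k := t)) j - (\<xi>(k := t)) i\<bar>) = ?C"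
    by (rule prod.cong) auto
  moreover have "(\<Prod>j\<in>{1..n} - {k}. \<bar>(\<xi>(k := t)) k - (\<xi>(k := t)) j\<bar>) = (\<Prod>j\<in>{1..n} - {k}. \<bar>t - \<xi> j\<bar>)"
    by (rule prod.cong) auto
  ultimately have "?C * (\<Prod>j\<in>{1..n} - {k}. \<bar>t - \<xi> j\<bar>) = node_prod n (\<xi>(k := t))"
    by (simp only: node_prod_remove[OF k, of "\<xi>(k := t)"])
  also have "\<dots> \<le> node_prod n \<xi>"
    using \<xi> t by (simp add: fekete_nodes_iff)
  also have "\<dots> = ?C * (\<Prod>j\<in>{1..n} - {k}. \<bar>\<xi> k - \<xi> j\<bar>)"
    by (rule node_prod_remove[OF k])
  finally show ?thesis
    using \<open>?C > 0\<close> by simp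
qed

text \<open>Otherwise moving the last node to \<open>1\<close> would strictly increase its distance
  to every other node.\<close>

lemma fekete_nodes_last:
  assumes \<xi>: "fekete_nodes n \<xi>" and n: "n \<ge> 2"
  shows "\<xi> n = 1"
proof (rule ccontr)
  assume "\<xi> n \<noteq> 1"
  have o: "ordered_nodes n \<xi>"
    using \<xi> by (simp add: fekete_nodes_iff)
  have lt: "\<xi> n < 1" using ordered_nodes_bounds[OF o, of n] n \<open>\<xi> n \<noteq> 1\<close> by auto
  have less: "\<xi> i < \<xi> n" if "i \<in> {1..n} - {n}" for i
    using that n by (intro ordered_nodes_less[OF o]) auto
  have "\<xi> i < 1" if "1 \<le> i" "i < n" for i
    using less[of i] lt that by simp
  then have "ordered_nodes n (\<xi>(n := 1))"
    by (intro ordered_nodes_fun_upd[OF o]) auto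
  then have "(\<Prod>j\<in>{1..n} - {n}. \<bar>1 - \<xi> j\<bar>) \<le> (\<Prod>j\<in>{1..n} - {n}. \<bar>\<xi> n - \<xi> j\<bar>)"
    using n by (intro fekete_nodes_move_one[OF \<xi>]) auto
  moreover have "(\<Prod>j\<in>{1..n} - {n}. \<bar>\<xi> n - \<xi> j\<bar>) < (\<Prod>j\<in>{1..n} - {n}. \<bar>1 - \<xi> j\<bar>)"
  \<comment> \<open>Strictness needs one actual factor; node \<open>1\<close> supplies it because
    \<open>n \<ge> 2\<close>.\<close>
  proof (rule prod_mono_strict[of 1])
    have strict: "\<bar>\<xi> n - \<xi> j\<bar> < \<bar>1 - \<xi> j\<bar>" if "j \<in> {1..n} - {n}" for j
      using less[OF that] lt by linarith
    show "1 \<in> {1..n} - {n}" using n by simp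
    then show "\<bar>\<xi> n - \<xi> 1\<bar> < \<bar>1 - \<xi> 1\<bar>" by (rule strict)
    show "0 \<le> \<bar>\<xi> n - \<xi> j\<bar> \<and> \<bar>\<xi> n - \<xi> j\<bar> \<le> \<bar>1 - \<xi> j\<bar>" if "j \<in> {1..n} - {n}" for j
      using strict[OF that] by linarith
    show "0 < \<bar>1 - \<xi> j\<bar>" if "j \<in> {1..n} - {n}" for j
      using strict[OF that] by linarith
  qed simp
  ultimately show False by simp
qed

lemma fekete_nodes_first:
  assumes \<xi>: "fekete_nodes n \<xi>" and n: "n \<ge> 2"
  shows "\<xi> 1 = -1"
proof (rule ccontr)
  assume "\<xi> 1 \<noteq> -1"
  have o: "ordered_nodes n \<xi>"
    using \<xi> by (simp add: fekete_nodes_iff)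
  have lt: "-1 < \<xi> 1" using ordered_nodes_bounds[OF o, of 1] n \<open>\<xi> 1 \<noteq> -1\<close> by auto
  have less: "\<xi> 1 < \<xi> i" if "i \<in> {1..n} - {1}" for i
    using that n by (intro ordered_nodes_less[OF o]) auto
  have "ordered_nodes n (\<xi>(1 := -1))"
    using less lt n by (intro ordered_nodes_fun_upd[OF o]) (auto intro: less_trans)
  then have "(\<Prod>j\<in>{1..n} - {1}. \<bar>-1 - \<xi> j\<bar>) \<le> (\<Prod>j\<in>{1..n} - {1}. \<bar>\<xi> 1 - \<xi> j\<bar>)"
    using n by (intro fekete_nodes_move_one[OF \<xi>]) auto
  moreover have "(\<Prod>j\<in>{1..n} - {1}. \<bar>\<xi> 1 - \<xi> j\<bar>) < (\<Prod>j\<in>{1..n} - {1}. \<bar>-1 - \<xi> j\<bar>)"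
  proof (rule prod_mono_strict[of n])
    have strict: "\<bar>\<xi> 1 - \<xi> j\<bar> < \<bar>-1 - \<xi> j\<bar>" if "j \<in> {1..n} - {1}" for j
      using less[OF that] lt by linarith
    show "n \<in> {1..n} - {1}" using n by simp
    then show "\<bar>\<xi> 1 - \<xi> n\<bar> < \<bar>-1 - \<xi> n\<bar>" by (rule strict)
    show "0 \<le> \<bar>\<xi> 1 - \<xi> j\<bar> \<and> \<bar>\<xi> 1 - \<xi> j\<bar> \<le> \<bar>-1 - \<xi> j\<bar>" if "j \<in> {1..n} - {1}" for j
      using strict[OF that] by linarith
    show "0 < \<bar>-1 - \<xi> j\<bar>" if "j \<in> {1..n} - {1}" for j
      using strict[OF that] by linarith
  qed simp
  ultimately show False by simp
qed

text \<open>With \<open>g\<close> the product over the other nodes, the nodal polynomial is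
  \<open>(x - \<xi> k) g\<close>, whose second derivative at \<open>\<xi> k\<close> is
  \<open>2 g'(\<xi> k)\<close>. This vanishes because the absolute value of \<open>g\<close> has a
  local maximum there.\<close>

lemma fekete_nodes_critical:
  assumes \<xi>: "fekete_nodes n \<xi>" and k: "1 < k" "k < n"
  shows "poly (pderiv (pderiv (newton_poly \<xi> n))) (\<xi> k) = 0"
proof -
  define g where "g = (\<Prod>j\<in>{1..n} - {k}. [:- \<xi> j, 1:])"
  have o: "ordered_nodes n \<xi>"
    using \<xi> by (simp add: fekete_nodes_iff)
  have near: "\<xi> (k - 1) < \<xi> k" "\<xi> k < \<xi> (k + 1)"
    using k by (auto intro!: ordered_nodes_less[OF o])
  have g_max: "\<bar>poly g t\<bar> \<le> \<bar>poly g (\<xi> k)\<bar>" if t: "\<xi> (k - 1) < t" "t < \<xi> (k + 1)" for t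
  proof -
    have "ordered_nodes n (\<xi>(k := t))"
    proof (rule ordered_nodes_fun_upd[OF o])
      show "\<xi> i < t" if "1 \<le> i" "i < k" for i
      proof -
        have "i \<le> k - 1" "k - 1 \<le> n" using that k by auto
        then show ?thesis
          using ordered_nodes_mono[OF o that(1)] t(1) by (meson le_less_trans)
      qed
      show "t < \<xi> i" if "k < i" "i \<le> n" for i
        using ordered_nodes_mono[OF o, of "k + 1" i] that t k by simp
      have "-1 \<le> \<xi> (k - 1)" "\<xi> (k + 1) \<le> 1"
        using ordered_nodes_bounds[OF o, of "k - 1"] ordered_nodes_bounds[OF o, of "k + 1"] k
        by simp_all
      then show "-1 \<le> t" "t \<le> 1" using t by linarith+
    qed
    from fekete_nodes_move_one[OF \<xi> _ this] show ?thesis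
      using k by (simp add: g_def poly_prod abs_prod)
  qed
  define d where "d = min (\<xi> k - \<xi> (k - 1)) (\<xi> (k + 1) - \<xi> k)"
  \<comment> \<open>Squaring replaces the absolute value by a differentiable function with the same
    local maximum.\<close>
  have "poly (pderiv (g * g)) (\<xi> k) = 0"
  proof (rule DERIV_local_max[OF poly_DERIV])
    show "0 < d" using near by (simp add: d_def)
    show "\<forall>y. \<bar>\<xi> k - y\<bar> < d \<longrightarrow> poly (g * g) y \<le> poly (g * g) (\<xi> k)"
    proof (intro allI impI)
      fix y assume "\<bar>\<xi> k - y\<bar> < d"
      then have "\<bar>poly g y\<bar> \<le> \<bar>poly g (\<xi> k)\<bar>"
        by (intro g_max) (auto simp: d_def)
      then show "poly (g * g) y \<le> poly (g * g) (\<xi> k)"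
        by (simp add: abs_le_square_iff power2_eq_square)
    qed
  qed
  moreover have "poly g (\<xi> k) \<noteq> 0"
    using k by (auto simp: g_def poly_prod dest!: inj_onD[OF ordered_nodes_inj_on[OF o], of k])
  ultimately have "poly (pderiv g) (\<xi> k) = 0"
    by (simp add: pderiv_mult)
  moreover have "newton_poly \<xi> n = [:- \<xi> k, 1:] * g"
    unfolding newton_poly_def g_def using k by (subst prod.remove[of _ k]) auto
  ultimately show ?thesis
    by (simp add: pderiv_mult pderiv_add pderiv_pCons del: mult_pCons_left mult_pCons_right)
qed

section \<open>Identification of maximizers with the Lobatto nodes\<close>

lemma newton_poly_fekete_ode:
  assumes \<xi>: "fekete_nodes n \<xi>" and n: "n \<ge> 2"
  shows "[:1, 0, -1:] * pderiv (pderiv (newton_poly \<xi> n))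
    = Polynomial.smult (- (of_nat n * (of_nat n - 1))) (newton_poly \<xi> n)"
proof -
  let ?\<omega> = "newton_poly \<xi> n"
  define q where "q = [:1, 0, -1:] * pderiv (pderiv ?\<omega>) + Polynomial.smult (of_nat n * (of_nat n - 1)) ?\<omega>"
  have inj: "inj_on \<xi> {1..n}"
    using \<xi> by (auto simp: fekete_nodes_iff dest: ordered_nodes_inj_on)
  have roots: "poly q (\<xi> k) = 0" if "k \<in> {1..n}" for k
  proof -
    \<comment> \<open>At the extreme nodes the first factor vanishes, at interior nodes the
      second.\<close>
    have "(1 - (\<xi> k)\<^sup>2) * poly (pderiv (pderiv ?\<omega>)) (\<xi> k) = 0"
      using fekete_nodes_first[OF assms] fekete_nodes_last[OF assms] fekete_nodes_critical[OF \<xi>, of k] that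
      by (cases "k = 1"; cases "k = n") auto
    then show ?thesis
      using poly_newton_poly_node[OF that, of \<xi>]
      by (simp add: q_def power2_eq_square algebra_simps)
  qed
  have "degree ([:1, 0, -1:] * pderiv (pderiv ?\<omega>)) \<le> n"
    using degree_mult_le[of "[:1, 0, -1:]" "pderiv (pderiv ?\<omega>)"] n
    by (simp add: degree_pderiv degree_newton_poly del: mult_pCons_left mult_pCons_right)
  then have "degree q \<le> n"
    unfolding q_def by (intro degree_add_le) (auto simp: degree_newton_poly)
  \<comment> \<open>The top coefficients cancel, so \<open>q\<close> has degree below
    \<open>n\<close> yet \<open>n\<close> distinct roots.\<close>
  moreover have "coeff q n = 0"
    using coeff_lobatto_operator[of ?\<omega> n]
    by (simp add: q_def degree_newton_poly coeff_newton_poly_same del: mult_pCons_left mult_pCons_right)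
  ultimately have "degree q < n"
    using n by (metis degree_0 leading_coeff_0_iff le_less less_le_trans zero_less_numeral)
  then have "q = 0"
    using roots n by (intro poly_eqI_degree[of "\<xi> ` {1..n}"]) (auto simp: card_image[OF inj, simplified])
  then show ?thesis
    by (simp add: q_def add_eq_0_iff del: mult_pCons_left mult_pCons_right)
qed

lemma lobatto_poly_eq_newton_poly:
  assumes "fekete_nodes n \<xi>" and n: "n \<ge> 2"
  shows "lobatto_poly n = Polynomial.smult (lead_coeff (lobatto_poly n)) (newton_poly \<xi> n)"
proof -
  define c where "c = lead_coeff (lobatto_poly n)"
  define d where "d = lobatto_poly n - Polynomial.smult c (newton_poly \<xi> n)"
  have "degree d \<le> n"
    unfolding d_def using n
    by (intro degree_diff_le) (auto simp: degree_lobatto_poly degree_newton_poly)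
  moreover have "coeff d n = 0"
    using n by (simp add: d_def c_def coeff_newton_poly_same degree_lobatto_poly)
  ultimately have "degree d < n"
    using n by (metis degree_0 leading_coeff_0_iff le_less less_le_trans zero_less_numeral)
  moreover have "[:1, 0, -1:] * pderiv (pderiv d)
      = Polynomial.smult (- (of_nat n * (of_nat n - 1))) d" (is "_ = Polynomial.smult ?l d")
  proof -
    have "[:1, 0, -1:] * pderiv (pderiv d) = [:1, 0, -1:] * pderiv (pderiv (lobatto_poly n))
        - Polynomial.smult c ([:1, 0, -1:] * pderiv (pderiv (newton_poly \<xi> n)))"
      by (simp only: d_def pderiv_diff pderiv_smult right_diff_distrib mult_smult_right)
    also have "\<dots> = Polynomial.smult ?l (lobatto_poly n)
        - Polynomial.smult c (Polynomial.smult ?l (newton_poly \<xi> n))"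
      using n by (simp only: lobatto_poly_ode newton_poly_fekete_ode[OF assms])
    also have "\<dots> = Polynomial.smult ?l d"
      by (simp only: d_def smult_diff_right smult_smult mult.commute)
    finally show ?thesis .
  qed
  ultimately have "d = 0"
    using lobatto_ode_low_degree n by blast
  then show ?thesis by (simp add: d_def c_def)
qed

text \<open>Proportional polynomials have the same zeros. That the Lobatto polynomial has
  \<open>n\<close> distinct real roots in \<open>[-1, 1]\<close> is thus inherited from a
  maximizer.\<close>

lemma lobatto_roots_eq_fekete:
  assumes "fekete_nodes n \<xi>" and n: "n \<ge> 2"
  shows "lobatto_roots n = \<xi> ` {1..n}"
proof -
  have "lobatto_poly n \<noteq> 0"
    using degree_lobatto_poly[OF n] n by auto
  have "lobatto_roots n = {x. poly (lobatto_poly n) x = 0}"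
    by (simp add: lobatto_roots_def lobatto_poly_def power2_eq_square algebra_simps)
  also have "\<dots> = {x. poly (newton_poly \<xi> n) x = 0}"
    using \<open>lobatto_poly n \<noteq> 0\<close> by (subst lobatto_poly_eq_newton_poly[OF assms]) simp
  also have "\<dots> = \<xi> ` {1..n}"
    by (auto simp: poly_newton_poly)
  finally show ?thesis .
qed

lemma fekete_nodes_eq_lobatto:
  assumes \<xi>: "fekete_nodes n \<xi>" and n: "n \<ge> 2" and i: "i \<in> {1..n}"
  shows "\<xi> i = lobatto_node n i"
proof -
  have o: "ordered_nodes n \<xi>"
    using \<xi> by (simp add: fekete_nodes_iff)
  have "sorted_wrt (<) (map \<xi> [1..<n + 1])"
    unfolding sorted_wrt_map
    by (rule sorted_wrt_mono_rel[OF _ sorted_wrt_upt]) (auto intro!: ordered_nodes_less[OF o])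
  then have "sorted_list_of_set (set (map \<xi> [1..<n + 1])) = map \<xi> [1..<n + 1]"
    by (intro sorted_list_of_set.idem_if_sorted_distinct) (auto simp: strict_sorted_iff)
  moreover have "set (map \<xi> [1..<n + 1]) = lobatto_roots n"
    unfolding lobatto_roots_eq_fekete[OF \<xi> n] by (simp add: atLeastLessThanSuc_atLeastAtMost del: upt_Suc)
  \<comment> \<open>Nodes are counted from 1, list positions from 0.\<close>
  moreover have "map \<xi> [1..<n + 1] ! (i - 1) = \<xi> i"
    using i by (subst nth_map) (auto simp del: upt_Suc)
  ultimately show ?thesis
    by (simp only: lobatto_node_def)
qed

text \<open>Some maximizer exists and agrees with \<open>lobatto_node n\<close> on
  \<open>{1..n}\<close>, and being a maximizer depends only on these values.\<close>

lemma fekete_nodes_lobatto: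
  assumes n: "n \<ge> 2"
  shows "fekete_nodes n (lobatto_node n)"
proof -
  from fekete_nodes_exist obtain \<xi> where "fekete_nodes n \<xi>" by blast
  with fekete_nodes_eq_lobatto[OF this n] show ?thesis
    using node_prod_cong[of n \<xi> "lobatto_node n"] ordered_nodes_cong[of n \<xi> "lobatto_node n"]
    by (simp add: fekete_nodes_iff)
qed

theorem theorem14:
  fixes r :: nat and B :: "nat \<Rightarrow> real poly"
  assumes "r \<ge> 1"
    and "poly_basis r B"
  shows "lobatto_node (r + 1) ` {1..r + 1} = lobatto_roots (r + 1) \<and>
         ordered_nodes (r + 1) (lobatto_node (r + 1)) \<and>
         fekete_nodes (r + 1) (lobatto_node (r + 1)) \<and>
         (\<forall>S. fekete_segments r B S \<longleftrightarrow>
            (\<forall>i\<in>{1..r}. S i = {lobatto_node (r + 1) i..lobatto_node (r + 1) (i + 1)}))"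
proof (intro conjI allI)
  let ?L = "lobatto_node (r + 1)"
  have n: "r + 1 \<ge> 2" using assms(1) by simp
  show L: "fekete_nodes (r + 1) ?L" by (rule fekete_nodes_lobatto[OF n])
  show "?L ` {1..r + 1} = lobatto_roots (r + 1)"
    using lobatto_roots_eq_fekete[OF L n] ..
  show oL: "ordered_nodes (r + 1) ?L"
    using L by (simp add: fekete_nodes_iff)
  fix S
  let ?D = "\<lambda>S. \<bar>Determinant.det (vandermonde_segments r B S)\<bar>"
  \<comment> \<open>On concatenated segments the determinant is a fixed positive multiple of the
    node product, for any choice of nodes describing them; maximality therefore transfers in both
    directions.\<close>
  obtain c where c: "c > 0"
    and D: "\<And>S \<xi>. ordered_nodes (r + 1) \<xi> \<Longrightarrow> \<forall>i\<in>{1..r}. S i = {\<xi> i..\<xi> (i + 1)} \<Longrightarrow>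
      ?D S = c * node_prod (r + 1) \<xi>"
    by (rule abs_det_vandermonde_segments[OF assms(2,1)]) blast
  show "fekete_segments r B S \<longleftrightarrow> (\<forall>i\<in>{1..r}. S i = {?L i..?L (i + 1)})"
  proof
    assume S: "fekete_segments r B S"
    then obtain \<xi> where \<xi>: "ordered_nodes (r + 1) \<xi>" "\<forall>i\<in>{1..r}. S i = {\<xi> i..\<xi> (i + 1)}"
      by (auto simp: fekete_segments_def is_arg_max_def concatenated_segments_def)
    have "node_prod (r + 1) \<eta> \<le> node_prod (r + 1) \<xi>" if \<eta>: "ordered_nodes (r + 1) \<eta>" for \<eta>
    proof -
      let ?T = "\<lambda>i. {\<eta> i..\<eta> (i + 1)}"
      have "concatenated_segments r ?T"
        using \<eta> by (auto simp: concatenated_segments_def)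
      then have "?D ?T \<le> ?D S"
        using S by (auto simp: fekete_segments_def is_arg_max_def not_less)
      then show ?thesis
        using D[OF \<xi>] D[OF \<eta>, of ?T] c by simp
    qed
    then have "fekete_nodes (r + 1) \<xi>"
      using \<xi>(1) by (auto simp: fekete_nodes_iff)
    from fekete_nodes_eq_lobatto[OF this n] show "\<forall>i\<in>{1..r}. S i = {?L i..?L (i + 1)}"
      using \<xi>(2) by simp
  next
    assume S: "\<forall>i\<in>{1..r}. S i = {?L i..?L (i + 1)}"
    have "?D T \<le> ?D S" if T: "concatenated_segments r T" for T
    proof -
      from T obtain \<eta> where \<eta>: "ordered_nodes (r + 1) \<eta>" "\<forall>i\<in>{1..r}. T i = {\<eta> i..\<eta> (i + 1)}"
        by (auto simp: concatenated_segments_def)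
      then show ?thesis
        using D[OF \<eta>] D[OF oL S] L c by (simp add: fekete_nodes_iff)
    qed
    moreover have "concatenated_segments r S"
      using S oL by (auto simp: concatenated_segments_def)
    ultimately show "fekete_segments r B S"
      by (auto simp: fekete_segments_def is_arg_max_def not_less)
  qed
qed

end
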